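(* Let $1<p<\infty$ and $0\leq\lambda<n$. Then the Hardy-Littlewood maximal operator $M$ is bounded in $V^{(\ast)}L^{p,\lambda}(\mathbb{R}^n)$; that is, $Mf\in V^{(\ast)}L^{p,\lambda}(\mathbb{R}^n)$ for every $f\in V^{(\ast)}L^{p,\lambda}(\mathbb{R}^n)$, and $\|Mf\|_{p,\lambda}\leq C\|f\|_{p,\lambda}$ with $C$ independent of $f$.
   Context: For $x\in\mathbb{R}^n$, $r>0$, let $B(x,r)$ be the open ball. The Morrey space $L^{p,\lambda}(\mathbb{R}^n)$ consists of all locally $p$-integrable $f$ on $\mathbb{R}^n$ with $\|f\|_{p,\lambda}:=\sup_{x\in\mathbb{R}^n,\,r>0}\left(\frac{1}{r^\lambda}\int_{B(x,r)}|f(y)|^p\,dy\right)^{1/p}<\infty$. The subspace $V^{(\ast)}L^{p,\lambda}(\mathbb{R}^n)$ consists of all $f\in L^{p,\lambda}(\mathbb{R}^n)$ with $$\lim_{N\to\infty}\ \sup_{x\in\mathbb{R}^n}\int_{B(x,1)}|f(y)|^p\,\chi_N(y)\,dy=0,\qquad \chi_N:=\chi_{\mathbb{R}^n\setminus B(0,N)},\ N\in\mathbb{N}.$$ The maximal operator is $Mf(x):=\sup_{t>0}\frac{1}{|B(x,t)|}\int_{B(x,t)}|f(y)|\,dy$. *)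

theory Defs
  imports "HOL-Analysis.Analysis"
begin

text \<open>
  Functions take values in a type of class \<^class>\<open>real_normed_field\<close>, so that the real and the
  complex function spaces are covered at once (by Mazur's theorem there are no other such fields).
  Elements of the spaces are functions rather than classes of functions modulo null sets.
\<close>

definition locally_p_integrable :: "real \<Rightarrow> (real ^ 'n \<Rightarrow> 'k::real_normed_field) \<Rightarrow> bool" where
  "locally_p_integrable p f \<longleftrightarrow>
     f \<in> borel_measurable lebesgue \<and>
     (\<forall>K. compact K \<longrightarrow> set_integrable lebesgue K (\<lambda>y. norm (f y) powr p))"

definition morrey_quotient ::
  "real \<Rightarrow> real \<Rightarrow> (real ^ 'n \<Rightarrow> 'k::real_normed_field) \<Rightarrow> real ^ 'n \<Rightarrow> real \<Rightarrow> real" where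
  "morrey_quotient p lam f x r =
     (1 / r powr lam * (LINT y:ball x r|lebesgue. norm (f y) powr p)) powr (1 / p)"

text \<open>The supremum is taken in the reals, so it is meaningful only for members of the space
  below, whose definition asks for boundedness.\<close>

definition morrey_norm :: "real \<Rightarrow> real \<Rightarrow> (real ^ 'n \<Rightarrow> 'k::real_normed_field) \<Rightarrow> real" where
  "morrey_norm p lam f = (SUP (x, r) \<in> UNIV \<times> {0<..}. morrey_quotient p lam f x r)"

definition morrey_space :: "real \<Rightarrow> real \<Rightarrow> (real ^ 'n \<Rightarrow> 'k::real_normed_field) set" where
  "morrey_space p lam =
     {f. locally_p_integrable p f \<and>
         bdd_above ((\<lambda>(x, r). morrey_quotient p lam f x r) ` (UNIV \<times> {0<..}))}"

text \<open>For members of the Morrey space the integrals in the next definition are bounded by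
  the \<open>p\<close>-th power of the Morrey norm (take radius 1), so the real supremum is the true one.\<close>

definition vanishing_morrey_space ::
  "real \<Rightarrow> real \<Rightarrow> (real ^ 'n \<Rightarrow> 'k::real_normed_field) set" where
  "vanishing_morrey_space p lam =
     {f \<in> morrey_space p lam.
        (\<lambda>N::nat. SUP x. LINT y:ball x 1|lebesgue.
           norm (f y) powr p * indicator (- ball 0 (real N)) y) \<longlonglongrightarrow> 0}"

text \<open>The maximal function may be infinite at some points, hence the extended values.\<close>

definition maximal_function :: "(real ^ 'n \<Rightarrow> 'k::real_normed_field) \<Rightarrow> real ^ 'n \<Rightarrow> ennreal" where
  "maximal_function f x =
     (SUP t \<in> {0<..}. (\<integral>\<^sup>+ y\<in>ball x t. ennreal (norm (f y)) \<partial>lebesgue) / emeasure lebesgue (ball x t))"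

text \<open>The scalar-valued representative of the maximal function; \<^const>\<open>enn2real\<close> sends \<open>\<infinity>\<close> to 0,
  which is harmless exactly when the maximal function is finite almost everywhere.\<close>

definition maximal_operator ::
  "(real ^ 'n \<Rightarrow> 'k::real_normed_field) \<Rightarrow> real ^ 'n \<Rightarrow> 'k" where
  "maximal_operator f x = of_real (enn2real (maximal_function f x))"

end

theory Submission
  imports Defs
begin

text \<open>
  Everything rests on one local estimate. Fix a ball \<open>B(x, r)\<close> and a radius \<open>R \<ge> r\<close>. For
  \<open>y \<in> B(x, r)\<close>, an average of \<open>|f|\<close> over \<open>B(y, t)\<close> with \<open>t \<le> R\<close> only sees \<open>f\<close> on \<open>B(x, 2R)\<close>,
  while for \<open>t > R\<close> the Morrey condition bounds it by a multiple of
  \<open>R powr ((\<lambda> - n) / p) * \<parallel>f\<parallel>\<close>. With the strong type \<open>(p, p)\<close> inequality for \<open>f\<close> restricted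
  to \<open>B(x, 2R)\<close>, the integral of \<open>(M f) powr p\<close> over \<open>B(x, r)\<close> is at most
  \<open>K \<integral> |f| powr p\<close> over \<open>B(x, 2R)\<close> plus a multiple of \<open>R powr (\<lambda> - n) * r ^ n * \<parallel>f\<parallel> powr p\<close>.
  Taking \<open>R = r\<close> gives boundedness in the Morrey norm. Taking \<open>r = 1\<close> and \<open>R\<close> large makes the
  second term small because \<open>\<lambda> < n\<close>, and the first term is handled by covering \<open>B(x, 2R)\<close> with a
  number of unit balls that does not depend on \<open>x\<close>.
\<close>

subsection \<open>Weak and strong type inequalities\<close>

text \<open>Stated over \<open>lborel\<close> for extended-valued functions, so that Tonelli
  applies, infinite values need no side conditions and truncations of \<open>g\<close> stay in the
  same class. A function \<open>f\<close> enters later through a Borel representative of its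
  norm.\<close>

definition hl_max :: "('a::euclidean_space \<Rightarrow> ennreal) \<Rightarrow> 'a \<Rightarrow> ennreal" where
  "hl_max g x = (SUP t\<in>{0<..}. (\<integral>\<^sup>+ y\<in>ball x t. g y \<partial>lborel) / emeasure lborel (ball x t))"

section \<open>Elementary properties and lower semicontinuity of the maximal function\<close>

lemma less_divide_ennreal:
  fixes a b c :: ennreal
  shows "b \<noteq> 0 \<Longrightarrow> b < top \<Longrightarrow> c < a / b \<longleftrightarrow> c * b < a"
  by (cases a; cases b; cases c)
     (auto simp: divide_ennreal ennreal_mult[symmetric] ennreal_less_iff field_simps
        ennreal_top_mult ennreal_top_divide ennreal_mult_less_top)

lemma emeasure_lborel_ball_pos:
  fixes x :: "'a::euclidean_space"
  assumes "0 < t"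
  shows "emeasure lborel (ball x t) \<noteq> 0" "emeasure lborel (ball x t) < top"
  using assms by (auto simp: emeasure_ball ennreal_eq_0_iff not_le)

lemma emeasure_lborel_ball_mult:
  fixes x z :: "'a::euclidean_space"
  assumes "0 \<le> t" "0 \<le> k"
  shows "emeasure lborel (ball x (k * t)) = ennreal (k ^ DIM('a)) * emeasure lborel (ball z t)"
  using assms by (simp add: emeasure_ball ennreal_mult[symmetric] power_mult_distrib ac_simps)

lemma less_hl_max_iff:
  "c < hl_max g x \<longleftrightarrow> (\<exists>t>0. c * emeasure lborel (ball x t) < (\<integral>\<^sup>+ y\<in>ball x t. g y \<partial>lborel))"
  by (auto simp: hl_max_def less_SUP_iff less_divide_ennreal emeasure_lborel_ball_pos)

text \<open>If the average over \<open>ball x t\<close> exceeds \<open>c\<close>, a slightly smaller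
  concentric ball already carries enough mass of \<open>g\<close>. That smaller ball lies in
  \<open>ball z t\<close> for every \<open>z\<close> close to \<open>x\<close>, and
  \<open>ball z t\<close> has the same volume as \<open>ball x t\<close>.\<close>

lemma open_less_hl_max:
  assumes [measurable]: "g \<in> borel_measurable borel"
  shows "open {x. c < hl_max g x}"
  unfolding open_contains_ball
proof safe
  fix x assume "c < hl_max g x"
  then obtain t where t: "t > 0" "c * emeasure lborel (ball x t) < (\<integral>\<^sup>+ y\<in>ball x t. g y \<partial>lborel)"
    by (auto simp: less_hl_max_iff)
  \<comment> \<open>The radii increase to \<open>t\<close>; some may be nonpositive, which only
    gives empty balls.\<close>
  let ?A = "\<lambda>k. ball x (t - inverse (real (Suc k)))"
  have inc: "incseq ?A"
    by (intro incseq_SucI subset_ball) (simp add: field_simps)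
  have "(\<Union>k. ?A k) = ball x t"
  proof (intro equalityI subsetI)
    fix y assume "y \<in> ball x t"
    then obtain k where "inverse (real (Suc k)) < t - dist x y"
      using reals_Archimedean[of "t - dist x y"] by auto
    then show "y \<in> (\<Union>k. ?A k)" by (auto intro!: exI[of _ k])
  next
    fix y assume "y \<in> (\<Union>k. ?A k)"
    then obtain k where "dist x y < t - inverse (real (Suc k))" by auto
    moreover have "0 < inverse (real (Suc k))" by simp
    ultimately show "y \<in> ball x t" unfolding mem_ball by linarith
  qed
  \<comment> \<open>Reading the integral as the measure \<open>density lborel g\<close> turns the
    passage to smaller balls into continuity from below.\<close>
  then have "(\<integral>\<^sup>+ y\<in>ball x t. g y \<partial>lborel) = emeasure (density lborel g) (\<Union>k. ?A k)"
    by (simp add: emeasure_density)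
  also have "\<dots> = (SUP k. emeasure (density lborel g) (?A k))"
    using inc by (intro SUP_emeasure_incseq[symmetric]) auto
  finally have "\<exists>k. c * emeasure lborel (ball x t) < emeasure (density lborel g) (?A k)"
    using t by (auto simp: less_SUP_iff)
  then obtain k where k: "c * emeasure lborel (ball x t) < (\<integral>\<^sup>+ y\<in>?A k. g y \<partial>lborel)"
    by (auto simp: emeasure_density)
  show "\<exists>e>0. ball x e \<subseteq> {x. c < hl_max g x}"
  proof (intro exI[of _ "inverse (real (Suc k))"] conjI subsetI)
    fix z assume z: "z \<in> ball x (inverse (real (Suc k)))"
    have "?A k \<subseteq> ball z t"
    proof
      fix y assume "y \<in> ?A k"
      then show "y \<in> ball z t" using z dist_triangle[of z y x] by (simp add: dist_commute)
    qed
    then have "(\<integral>\<^sup>+ y\<in>?A k. g y \<partial>lborel) \<le> (\<integral>\<^sup>+ y\<in>ball z t. g y \<partial>lborel)"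
      by (intro nn_integral_mono) (auto split: split_indicator)
    with k t show "z \<in> {x. c < hl_max g x}"
      by (auto simp: less_hl_max_iff emeasure_ball intro!: exI[of _ t])
  qed simp
qed

lemma borel_measurable_hl_max [measurable]:
  assumes "g \<in> borel_measurable borel"
  shows "hl_max g \<in> borel_measurable borel"
  by (rule borel_measurableI_greater) (simp add: open_less_hl_max assms)

lemma hl_max_mono:
  assumes "\<And>y. g y \<le> h y"
  shows "hl_max g x \<le> hl_max h x"
  unfolding hl_max_def
  by (intro SUP_mono' divide_right_mono_ennreal nn_integral_mono mult_right_mono assms) auto

text \<open>Averaging a constant returns it. This lets the truncation argument below discard the
  part of \<open>g\<close> under a fixed height.\<close>

lemma hl_max_add_const:
  assumes [measurable]: "g \<in> borel_measurable borel"
  shows "hl_max (\<lambda>y. g y + c) x \<le> hl_max g x + c"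
  unfolding hl_max_def
proof (rule SUP_least)
  fix t :: real assume t: "t \<in> {0<..}"
  then have "0 < t" by simp
  note pos = emeasure_lborel_ball_pos[OF this, of x]
  have [measurable]: "ball x t \<in> sets borel" by simp
  have m: "(\<lambda>y. g y * indicator (ball x t) y) \<in> borel_measurable lborel"
    "(\<lambda>y. c * indicator (ball x t) y) \<in> borel_measurable lborel"
    by measurable
  have "(\<integral>\<^sup>+ y\<in>ball x t. (g y + c) \<partial>lborel) / emeasure lborel (ball x t)
      = (\<integral>\<^sup>+ y\<in>ball x t. g y \<partial>lborel) / emeasure lborel (ball x t) + c"
    unfolding distrib_right using pos
    by (subst nn_integral_add) (auto simp: m nn_integral_cmult_indicator add_divide_distrib_ennreal
        ennreal_times_divide[symmetric])
  also have "\<dots> \<le> (SUP t\<in>{0<..}. (\<integral>\<^sup>+ y\<in>ball x t. g y \<partial>lborel) / emeasure lborel (ball x t)) + c"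
    using t by (intro add_right_mono SUP_upper)
  finally show "(\<integral>\<^sup>+ y\<in>ball x t. (g y + c) \<partial>lborel) / emeasure lborel (ball x t) \<le> \<dots>" .
qed

text \<open>Every point of the superlevel set is the centre of a ball whose \<open>g\<close>-mass
  exceeds \<open>c\<close> times its volume. Vitali's lemma selects disjoint balls whose fivefold
  enlargements still cover the set: the enlargement costs \<open>5 ^ DIM('a)\<close>, and
  disjointness bounds the sum of the masses by the whole integral.\<close>

lemma hl_max_weak_type:
  fixes g :: "'a::euclidean_space \<Rightarrow> ennreal"
  assumes [measurable]: "g \<in> borel_measurable borel"
  shows "c * emeasure lborel {x. c < hl_max g x} \<le> 5 ^ DIM('a) * (\<integral>\<^sup>+ y. g y \<partial>lborel)"
proof -
  let ?E = "{x. c < hl_max g x}" and ?I = "\<integral>\<^sup>+ y. g y \<partial>lborel"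
  \<comment> \<open>Only the last case has content: for \<open>c = top\<close> the superlevel set is
    empty, and the other two are trivial by their values.\<close>
  consider "c = 0" | "c = top" | "?I = top" | "0 < c" "c < top" "?I < top"
    by (metis less_top not_gr_zero)
  then show ?thesis
  proof cases
    case 4
    have "\<forall>x\<in>?E. \<exists>t>0. c * emeasure lborel (ball x t) < (\<integral>\<^sup>+ y\<in>ball x t. g y \<partial>lborel)"
      by (auto simp: less_hl_max_iff)
    then obtain t where t: "\<And>x. x \<in> ?E \<Longrightarrow> 0 < t x"
      "\<And>x. x \<in> ?E \<Longrightarrow> c * emeasure lborel (ball x (t x)) < (\<integral>\<^sup>+ y\<in>ball x (t x). g y \<partial>lborel)"
      by metis
    obtain c' where c': "c = ennreal c'" "0 < c'"
      using 4 by (cases c) auto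
    obtain I where I: "?I = ennreal I" "0 \<le> I"
      using 4 by (cases ?I) auto
    define w where "w = unit_ball_vol DIM('a)"
    have w: "w > 0" by (simp add: w_def)
    \<comment> \<open>Vitali's lemma needs bounded radii. The volume of a chosen ball is less than
      \<open>I / c'\<close>, and for a radius above 1 the power \<open>t x ^ DIM('a)\<close> is at
      least \<open>t x\<close>; hence the \<open>max 1\<close>.\<close>
    define B where "B = max 1 (I / (c' * w))"
    have "t x \<le> B" if x: "x \<in> ?E" for x
    proof (rule ccontr)
      assume *: "\<not> t x \<le> B"
      then have "1 < t x" "I / (c' * w) < t x" by (auto simp: B_def)
      have "c * emeasure lborel (ball x (t x)) < ?I"
        by (rule less_le_trans[OF t(2)[OF x]]) (auto intro!: nn_integral_mono split: split_indicator)
      then have "c' * (w * t x ^ DIM('a)) < I"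
        using t(1)[OF x] I c' w by (simp add: emeasure_ball ennreal_mult[symmetric] ennreal_less_iff w_def)
      moreover have "t x ^ 1 \<le> t x ^ DIM('a)"
        using \<open>1 < t x\<close> by (intro power_increasing) (auto simp: Suc_le_eq)
      then have "c' * (w * t x) \<le> c' * (w * t x ^ DIM('a))"
        using c' w by simp
      moreover have "I < c' * (w * t x)"
        using \<open>I / (c' * w) < t x\<close> c' w by (simp add: field_simps)
      ultimately show False by linarith
    qed
    with t(1) have r: "\<And>x. x \<in> ?E \<Longrightarrow> 0 < t x \<and> t x \<le> B" by auto
    have "?E \<subseteq> (\<Union>x\<in>?E. ball x (t x))" using t(1) by auto
    from Vitali_covering_lemma_balls[OF this r] obtain C where C: "countable C" "C \<subseteq> ?E"
      "pairwise (\<lambda>i j. disjnt (ball i (t i)) (ball j (t j))) C"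
      "?E \<subseteq> (\<Union>i\<in>C. ball i (5 * t i))"
      by blast
    have "c * emeasure lborel ?E \<le> c * emeasure lborel (\<Union>i\<in>C. ball i (5 * t i))"
      using C(4) by (intro mult_left_mono emeasure_mono) (auto intro!: borel_open open_UN)
    \<comment> \<open>Countable subadditivity over the index set \<open>C\<close>: the indicator of
      the union is at most the sum of the indicators, and Tonelli exchanges that sum with the
      integral.\<close>
    also have "emeasure lborel (\<Union>i\<in>C. ball i (5 * t i)) \<le> (\<integral>\<^sup>+ i. emeasure lborel (ball i (5 * t i)) \<partial>count_space C)"
    proof -
      have "emeasure lborel (\<Union>i\<in>C. ball i (5 * t i))
        = (\<integral>\<^sup>+ x. indicator (\<Union>i\<in>C. ball i (5 * t i)) x \<partial>lborel)"
        by (subst nn_integral_indicator) (auto intro!: borel_open open_UN)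
      also have "\<dots> \<le> (\<integral>\<^sup>+ x. \<integral>\<^sup>+ i. indicator (ball i (5 * t i)) x \<partial>count_space C \<partial>lborel)"
      proof (rule nn_integral_mono)
        fix x
        show "indicator (\<Union>i\<in>C. ball i (5 * t i)) x
          \<le> (\<integral>\<^sup>+ i. (indicator (ball i (5 * t i)) x :: ennreal) \<partial>count_space C)"
        proof (cases "x \<in> (\<Union>i\<in>C. ball i (5 * t i))")
          case True
          then obtain i where i: "i \<in> C" "x \<in> ball i (5 * t i)" by blast
          have "indicator (\<Union>i\<in>C. ball i (5 * t i)) x = (\<integral>\<^sup>+ j. indicator {i} j \<partial>count_space C)"
            using True i by (subst nn_integral_indicator) auto
          also have "\<dots> \<le> (\<integral>\<^sup>+ i. indicator (ball i (5 * t i)) x \<partial>count_space C)"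
            using i by (intro nn_integral_mono) (auto split: split_indicator)
          finally show ?thesis .
        qed simp
      qed
      also have "\<dots> = (\<integral>\<^sup>+ i. emeasure lborel (ball i (5 * t i)) \<partial>count_space C)"
        using C(1) by (subst nn_integral_count_space_nn_integral) (auto intro!: borel_measurable_indicator)
      finally show ?thesis .
    qed
    also have "\<dots> = (\<integral>\<^sup>+ i. 5 ^ DIM('a) * emeasure lborel (ball i (t i)) \<partial>count_space C)"
    proof (intro nn_integral_cong)
      fix i assume "i \<in> space (count_space C)"
      then have "0 \<le> t i" using C(2) t(1) by (auto intro: less_imp_le)
      then show "emeasure lborel (ball i (5 * t i)) = 5 ^ DIM('a) * emeasure lborel (ball i (t i))"
        using emeasure_lborel_ball_mult[of "t i" 5 i i] by (simp add: ennreal_power[symmetric])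
    qed
    also have "c * \<dots> = 5 ^ DIM('a) * (\<integral>\<^sup>+ i. c * emeasure lborel (ball i (t i)) \<partial>count_space C)"
      by (subst (1 2) nn_integral_cmult) (auto simp: ac_simps)
    also have "\<dots> \<le> 5 ^ DIM('a) * (\<integral>\<^sup>+ i. emeasure (density lborel g) (ball i (t i)) \<partial>count_space C)"
      using C(2) t(2) by (intro mult_left_mono nn_integral_mono)
        (auto simp: emeasure_density intro!: less_imp_le)
    also have "(\<integral>\<^sup>+ i. emeasure (density lborel g) (ball i (t i)) \<partial>count_space C)
      = emeasure (density lborel g) (\<Union>i\<in>C. ball i (t i))"
      using C(1,3) by (intro emeasure_UN_countable[symmetric])
        (auto simp: disjoint_family_on_def pairwise_def disjnt_def)
    also have "\<dots> \<le> emeasure (density lborel g) UNIV"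
      by (intro emeasure_mono) auto
    also have "\<dots> = ?I" by (simp add: emeasure_density)
    finally show ?thesis by (simp add: mult_left_mono)
  qed (auto simp: ennreal_mult_top)
qed

section \<open>Powers of extended nonnegative reals and the layer cake formula\<close>

text \<open>Infinity is kept as \<open>top\<close>, so that a finite integral of the power forces
  the base to be finite almost everywhere; \<open>enn2real\<close> alone would turn it into
  0.\<close>

definition enn_powr :: "ennreal \<Rightarrow> real \<Rightarrow> ennreal" where
  "enn_powr x p = (if x = top then top else ennreal (enn2real x powr p))"

lemma enn_powr_ennreal [simp]: "0 \<le> a \<Longrightarrow> enn_powr (ennreal a) p = ennreal (a powr p)"
  by (simp add: enn_powr_def)

lemma enn_powr_top [simp]: "enn_powr top p = top"
  by (simp add: enn_powr_def)

lemma enn_powr_zero [simp]: "enn_powr 0 p = 0"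
  by (simp add: enn_powr_def)

lemma borel_measurable_enn_powr [measurable]:
  assumes [measurable]: "f \<in> borel_measurable M"
  shows "(\<lambda>x. enn_powr (f x) p) \<in> borel_measurable M"
  unfolding enn_powr_def by measurable

lemma enn_powr_mono:
  assumes "x \<le> y" "0 \<le> p"
  shows "enn_powr x p \<le> enn_powr y p"
  using assms by (cases x; cases y) (auto simp: top_unique intro!: powr_mono2)

lemma enn_powr_max_le:
  assumes "0 \<le> p"
  shows "enn_powr (max x y) p \<le> enn_powr x p + enn_powr y p"
  by (simp add: max_def)

text \<open>Exponent bookkeeping for the strong type inequality, where it is used with
  \<open>c = 2\<close>: the factor \<open>g y\<close> from the weak type bound meets the power
  \<open>p - 1\<close> from the integral over the levels.\<close>

lemma mult_enn_powr:
  assumes "0 \<le> c" "0 < p"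
  shows "x * enn_powr (ennreal c * x) (p - 1) = ennreal (c powr (p - 1)) * enn_powr x p"
proof (cases x)
  case (real a)
  show ?thesis
  proof (cases "a = 0")
    case False
    with real have "a * (c * a) powr (p - 1) = c powr (p - 1) * a powr p"
      using assms by (simp add: powr_mult powr_diff)
    with real assms show ?thesis by (simp add: ennreal_mult[symmetric])
  qed (use real in simp)
next
  case top
  then show ?thesis using assms
    by (cases "c = 0") (auto simp: ennreal_mult_top ennreal_eq_0_iff)
qed

text \<open>The pointwise layer cake formula. For finite \<open>x\<close> it is the power rule on a
  closed interval, whose endpoints are null; for infinite \<open>x\<close> the integral dominates
  all the finite ones.\<close>

lemma nn_integral_powr_less:
  fixes x :: ennreal
  assumes "0 < q"
  shows "(\<integral>\<^sup>+ t. ennreal (t powr (q - 1)) * indicator {t. 0 < t \<and> ennreal t < x} t \<partial>lborel)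
    = enn_powr x q / ennreal q"
proof -
  have fin: "(\<integral>\<^sup>+ t. ennreal (t powr (q - 1)) * indicator {t. 0 < t \<and> ennreal t < ennreal a} t \<partial>lborel)
    = ennreal (a powr q / q)" if "0 \<le> a" for a
  proof -
    have "((\<lambda>t. t powr (q - 1)) has_integral (a powr (q - 1 + 1) / (q - 1 + 1))) {0..a}"
      using assms that by (intro has_integral_powr_from_0) auto
    moreover have "(\<lambda>t. if t \<in> {0..a} then t powr (q - 1) else 0) = (\<lambda>t. t powr (q - 1) * indicator {0..a} t)"
      by (auto simp: fun_eq_iff indicator_def)
    ultimately have "((\<lambda>t. t powr (q - 1) * indicator {0..a} t) has_integral (a powr q / q)) UNIV"
      by (subst (asm) has_integral_restrict_UNIV[symmetric]) simp
    then have "(\<integral>\<^sup>+ t. ennreal (t powr (q - 1) * indicator {0..a} t) \<partial>lborel) = ennreal (a powr q / q)"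
      by (intro nn_integral_has_integral_lborel) auto
    moreover have "(\<integral>\<^sup>+ t. ennreal (t powr (q - 1)) * indicator {t. 0 < t \<and> ennreal t < ennreal a} t \<partial>lborel)
      = (\<integral>\<^sup>+ t. ennreal (t powr (q - 1) * indicator {0..a} t) \<partial>lborel)"
      using AE_lborel_singleton[of a] AE_lborel_singleton[of 0]
      by (intro nn_integral_cong_AE, eventually_elim)
         (auto simp: indicator_def ennreal_less_iff)
    ultimately show ?thesis by simp
  qed
  show ?thesis
  proof (cases x)
    case (real a)
    then show ?thesis using fin[of a] assms by (simp add: divide_ennreal)
  next
    case top
    have "(\<integral>\<^sup>+ t. ennreal (t powr (q - 1)) * indicator {t. 0 < t \<and> ennreal t < x} t \<partial>lborel) = top" (is "?I = _")
    proof (rule ccontr)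
      assume "?I \<noteq> top"
      then obtain b where b: "?I = ennreal b" "0 \<le> b" by (cases ?I) auto
      \<comment> \<open>Chosen so that \<open>a powr q / q\<close> equals \<open>b + 1 / q\<close>,
        which exceeds the supposed value \<open>b\<close>.\<close>
      define a where "a = (b * q + 1) powr (1 / q)"
      have "ennreal (a powr q / q) \<le> ?I"
        unfolding fin[symmetric, of a, unfolded a_def, simplified, folded a_def] top
        by (intro nn_integral_mono) (auto split: split_indicator)
      moreover have "a powr q = b * q + 1"
        using assms b by (simp add: a_def powr_powr)
      ultimately have "(b * q + 1) / q \<le> b" using b assms by simp
      then show False using assms by (simp add: field_simps)
    qed
    with top assms show ?thesis by (simp add: ennreal_top_divide)
  qed
qed

section \<open>Marcinkiewicz interpolation between weak type (1,1) and the sup bound\<close>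

text \<open>Cut \<open>g\<close> at height \<open>t / 2\<close>. The low part adds at most
  \<open>t / 2\<close> to the maximal function, so level \<open>t\<close> for \<open>g\<close>
  forces level \<open>t / 2\<close> for the high part, to which the weak type inequality
  applies.\<close>

lemma hl_max_weak_type_truncated:
  fixes g :: "'a::euclidean_space \<Rightarrow> ennreal"
  assumes [measurable]: "g \<in> borel_measurable borel" and "0 < t"
  shows "ennreal (t / 2) * emeasure lborel {x. ennreal t < hl_max g x}
    \<le> 5 ^ DIM('a) * (\<integral>\<^sup>+ y. g y * indicator {y. ennreal t < ennreal 2 * g y} y \<partial>lborel)"
proof -
  let ?h = "\<lambda>y. g y * indicator {y. ennreal t < ennreal 2 * g y} y"
  have half: "ennreal t = ennreal (t / 2) + ennreal (t / 2)"
    using assms by (simp flip: ennreal_plus)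
  have "g y \<le> ?h y + ennreal (t / 2)" for y
    using assms by (cases "g y") (auto simp: ennreal_mult[symmetric] ennreal_less_iff ennreal_mult_top
        not_less simp del: ennreal_numeral split: split_indicator intro!: ennreal_leI)
  then have "hl_max g x \<le> hl_max ?h x + ennreal (t / 2)" for x
    by (intro order_trans[OF hl_max_mono hl_max_add_const]) auto
  then have "ennreal (t / 2) < hl_max ?h x" if "ennreal t < hl_max g x" for x
    using that unfolding half by (meson add_right_mono leD leI order_trans)
  then have "ennreal (t / 2) * emeasure lborel {x. ennreal t < hl_max g x}
    \<le> ennreal (t / 2) * emeasure lborel {x. ennreal (t / 2) < hl_max ?h x}"
    by (intro mult_left_mono emeasure_mono) auto
  also have "\<dots> \<le> 5 ^ DIM('a) * (\<integral>\<^sup>+ y. ?h y \<partial>lborel)"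
    by (rule hl_max_weak_type) measurable
  finally show ?thesis .
qed

text \<open>Write the power of the maximal function by layers, exchange the integrals, apply the
  truncated weak type bound at each level and exchange back. The inner integral of
  \<open>t powr (p - 2)\<close> up to \<open>2 * g y\<close> converges at 0 because
  \<open>1 < p\<close>, and yields the factor \<open>2 powr (p - 1) / (p - 1)\<close>.\<close>

lemma hl_max_strong_type:
  fixes g :: "'a::euclidean_space \<Rightarrow> ennreal"
  assumes [measurable]: "g \<in> borel_measurable borel" and p: "1 < p"
  shows "(\<integral>\<^sup>+ x. enn_powr (hl_max g x) p \<partial>lborel)
    \<le> ennreal (2 powr p * 5 ^ DIM('a) * p / (p - 1)) * (\<integral>\<^sup>+ x. enn_powr (g x) p \<partial>lborel)"
proof -
  let ?c = "5 ^ DIM('a) :: ennreal"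
  have "(\<integral>\<^sup>+ x. enn_powr (hl_max g x) p \<partial>lborel)
    = (\<integral>\<^sup>+ x. ennreal p * (\<integral>\<^sup>+ t. ennreal (t powr (p - 1)) * indicator {t. 0 < t \<and> ennreal t < hl_max g x} t \<partial>lborel) \<partial>lborel)"
    using p by (subst nn_integral_powr_less)
      (auto simp: ennreal_times_divide mult_divide_eq_ennreal mult.commute[of "ennreal p"])
  also have "\<dots> = ennreal p * (\<integral>\<^sup>+ x. \<integral>\<^sup>+ t. ennreal (t powr (p - 1)) * indicator {t. 0 < t \<and> ennreal t < hl_max g x} t \<partial>lborel \<partial>lborel)"
    by (rule nn_integral_cmult) measurable
  also have "(\<integral>\<^sup>+ x. \<integral>\<^sup>+ t. ennreal (t powr (p - 1)) * indicator {t. 0 < t \<and> ennreal t < hl_max g x} t \<partial>lborel \<partial>lborel)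
    = (\<integral>\<^sup>+ t. \<integral>\<^sup>+ x. ennreal (t powr (p - 1)) * indicator {t. 0 < t \<and> ennreal t < hl_max g x} t \<partial>lborel \<partial>lborel)"
    by (rule lborel_pair.Fubini') measurable
  also have "\<dots> \<le> (\<integral>\<^sup>+ t. \<integral>\<^sup>+ y. 2 * ?c * g y * (ennreal (t powr (p - 1 - 1)) * indicator {t. 0 < t \<and> ennreal t < ennreal 2 * g y} t) \<partial>lborel \<partial>lborel)"
  proof (rule nn_integral_mono)
    fix t :: real
    show "(\<integral>\<^sup>+ x. ennreal (t powr (p - 1)) * indicator {t. 0 < t \<and> ennreal t < hl_max g x} t \<partial>lborel)
      \<le> (\<integral>\<^sup>+ y. 2 * ?c * g y * (ennreal (t powr (p - 1 - 1)) * indicator {t. 0 < t \<and> ennreal t < ennreal 2 * g y} t) \<partial>lborel)"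
    proof (cases "0 < t")
      case True
      \<comment> \<open>Splits off the factor \<open>t / 2\<close> that stands on the left of the
        weak type bound.\<close>
      have eq: "ennreal (t powr (p - 1)) = ennreal (2 * t powr (p - 1 - 1)) * ennreal (t / 2)"
        using True by (simp add: powr_diff ennreal_mult[symmetric] field_simps power2_eq_square)
      have "(\<integral>\<^sup>+ x. ennreal (t powr (p - 1)) * indicator {t. 0 < t \<and> ennreal t < hl_max g x} t \<partial>lborel)
        = (\<integral>\<^sup>+ x. ennreal (t powr (p - 1)) * indicator {x. ennreal t < hl_max g x} x \<partial>lborel)"
        using True by (intro nn_integral_cong) (auto split: split_indicator)
      also have "\<dots> = ennreal (2 * t powr (p - 1 - 1)) * (ennreal (t / 2) * emeasure lborel {x. ennreal t < hl_max g x})"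
        by (subst nn_integral_cmult_indicator) (auto simp: eq mult.assoc)
      also have "\<dots> \<le> ennreal (2 * t powr (p - 1 - 1)) * (?c * (\<integral>\<^sup>+ y. g y * indicator {y. ennreal t < ennreal 2 * g y} y \<partial>lborel))"
        using True by (intro mult_left_mono hl_max_weak_type_truncated) auto
      also have "\<dots> = (\<integral>\<^sup>+ y. ennreal (2 * t powr (p - 1 - 1)) * ?c * (g y * indicator {y. ennreal t < ennreal 2 * g y} y) \<partial>lborel)"
        by (subst nn_integral_cmult) (auto simp: mult.assoc)
      also have "\<dots> = (\<integral>\<^sup>+ y. 2 * ?c * g y * (ennreal (t powr (p - 1 - 1)) * indicator {t. 0 < t \<and> ennreal t < ennreal 2 * g y} t) \<partial>lborel)"
        using True by (intro nn_integral_cong) (auto simp: ennreal_mult ac_simps split: split_indicator)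
      finally show ?thesis .
    qed simp
  qed
  also have "\<dots> = (\<integral>\<^sup>+ y. \<integral>\<^sup>+ t. 2 * ?c * g y * (ennreal (t powr (p - 1 - 1)) * indicator {t. 0 < t \<and> ennreal t < ennreal 2 * g y} t) \<partial>lborel \<partial>lborel)"
    by (rule lborel_pair.Fubini'[symmetric]) measurable
  also have "\<dots> = (\<integral>\<^sup>+ y. 2 * ?c * g y * (enn_powr (ennreal 2 * g y) (p - 1) / ennreal (p - 1)) \<partial>lborel)"
    using p by (subst nn_integral_cmult) (auto simp: nn_integral_powr_less[of "p - 1", simplified])
  also have "\<dots> = (\<integral>\<^sup>+ y. ennreal (2 powr p * 5 ^ DIM('a) / (p - 1)) * enn_powr (g y) p \<partial>lborel)"
  proof (rule nn_integral_cong)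
    fix y
    have c: "?c = ennreal (5 ^ DIM('a))" by (simp add: ennreal_power[symmetric])
    have "2 * ?c * g y * (enn_powr (ennreal 2 * g y) (p - 1) / ennreal (p - 1))
      = 2 * ?c * (g y * enn_powr (ennreal 2 * g y) (p - 1)) * (1 / ennreal (p - 1))"
      by (simp add: ennreal_times_divide mult.assoc)
    also have "\<dots> = (ennreal 2 * ?c * ennreal (2 powr (p - 1)) * (ennreal 1 / ennreal (p - 1))) * enn_powr (g y) p"
      using p by (subst mult_enn_powr) (auto simp: ac_simps)
    also have "ennreal 2 * ?c * ennreal (2 powr (p - 1)) * (ennreal 1 / ennreal (p - 1)) = ennreal (2 powr p * 5 ^ DIM('a) / (p - 1))"
      using p unfolding c by (subst divide_ennreal) (auto simp: ennreal_mult[symmetric] powr_diff simp del: ennreal_numeral)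
    finally show "2 * ?c * g y * (enn_powr (ennreal 2 * g y) (p - 1) / ennreal (p - 1))
      = ennreal (2 powr p * 5 ^ DIM('a) / (p - 1)) * enn_powr (g y) p" .
  qed
  also have "\<dots> = ennreal (2 powr p * 5 ^ DIM('a) / (p - 1)) * (\<integral>\<^sup>+ y. enn_powr (g y) p \<partial>lborel)"
    by (rule nn_integral_cmult) measurable
  finally have "(\<integral>\<^sup>+ x. enn_powr (hl_max g x) p \<partial>lborel)
    \<le> ennreal p * (ennreal (2 powr p * 5 ^ DIM('a) / (p - 1)) * (\<integral>\<^sup>+ y. enn_powr (g y) p \<partial>lborel))"
    by (simp add: mult_left_mono)
  also have "\<dots> = ennreal (2 powr p * 5 ^ DIM('a) * p / (p - 1)) * (\<integral>\<^sup>+ y. enn_powr (g y) p \<partial>lborel)"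
    using p by (subst mult.assoc[symmetric], subst ennreal_mult[symmetric]) (auto simp: ac_simps)
  finally show ?thesis .
qed

subsection \<open>Local estimates\<close>

definition strong_const :: "real \<Rightarrow> nat \<Rightarrow> real" where
  "strong_const p n = 2 powr p * 5 ^ n * p / (p - 1)"

lemma strong_const_pos: "1 < p \<Longrightarrow> 0 < strong_const p n"
  by (simp add: strong_const_def)

text \<open>A substitute for Jensen's inequality: it bounds an average of \<open>g\<close> by that of \<open>g powr p\<close> at the cost of a factor 2.\<close>

lemma le_add_enn_powr:
  assumes "0 < c" "1 < p"
  shows "x \<le> ennreal c + ennreal (c powr (1 - p)) * enn_powr x p"
proof (cases x)
  case (real a)
  have "a \<le> c + c powr (1 - p) * a powr p"
  proof (cases "a \<le> c")
    case False
    have "a = a powr (1 - p) * a powr p"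
      using False assms by (simp flip: powr_add)
    also have "\<dots> \<le> c powr (1 - p) * a powr p"
      using False assms by (intro mult_right_mono powr_mono2') auto
    finally show ?thesis using assms by simp
  qed (simp add: add_increasing2)
  then show ?thesis using real assms
    by (simp add: ennreal_mult[symmetric] flip: ennreal_plus)
qed (use assms in \<open>simp add: ennreal_mult_top\<close>)

text \<open>Apply \<open>le_add_enn_powr\<close> with the same \<open>c\<close> as in the
  hypothesis: since \<open>c powr (1 - p) * c powr p = c\<close>, each of the two terms contributes
  \<open>c\<close> times the volume.\<close>

lemma hl_max_average_bound:
  fixes g :: "'a::euclidean_space \<Rightarrow> ennreal"
  assumes [measurable]: "g \<in> borel_measurable borel" and p: "1 < p" and c: "0 < c" and t: "0 < t"
    and avg: "(\<integral>\<^sup>+ z\<in>ball y t. enn_powr (g z) p \<partial>lborel) \<le> ennreal (c powr p) * emeasure lborel (ball y t)"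
  shows "(\<integral>\<^sup>+ z\<in>ball y t. g z \<partial>lborel) / emeasure lborel (ball y t) \<le> ennreal (2 * c)"
proof -
  have [measurable]: "ball y t \<in> sets borel" by simp
  let ?B = "emeasure lborel (ball y t)"
  have "(\<integral>\<^sup>+ z\<in>ball y t. g z \<partial>lborel)
    \<le> (\<integral>\<^sup>+ z. ennreal c * indicator (ball y t) z
        + ennreal (c powr (1 - p)) * (enn_powr (g z) p * indicator (ball y t) z) \<partial>lborel)"
    using le_add_enn_powr[OF c p] by (intro nn_integral_mono) (auto split: split_indicator)
  also have "\<dots> = ennreal c * ?B + ennreal (c powr (1 - p)) * (\<integral>\<^sup>+ z\<in>ball y t. enn_powr (g z) p \<partial>lborel)"
    by (subst nn_integral_add, measurable) (simp add: nn_integral_cmult nn_integral_cmult_indicator)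
  also have "\<dots> \<le> ennreal c * ?B + ennreal (c powr (1 - p)) * (ennreal (c powr p) * ?B)"
    by (intro add_left_mono mult_left_mono avg) auto
  also have "\<dots> = ?B * ennreal (2 * c)"
  proof -
    have "ennreal (c powr (1 - p)) * ennreal (c powr p) = ennreal c"
      using c by (simp add: ennreal_mult[symmetric] flip: powr_add)
    moreover have "ennreal (2 * c) = ennreal c + ennreal c"
      using c by (simp flip: ennreal_plus)
    ultimately show ?thesis by (simp add: distrib_left distrib_right mult.assoc[symmetric] mult.commute)
  qed
  finally show ?thesis
    using emeasure_lborel_ball_pos[OF t, of y] by (intro divide_le_posI_ennreal) (auto simp: zero_less_iff_neq_zero)
qed

text \<open>The splitting of radii at \<open>R\<close>, with the Morrey condition reduced to a bound
  \<open>c powr p\<close> on averages over balls of radius above \<open>R\<close>. Small radii see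
  only \<open>g\<close> cut off to \<open>ball x (2 * R)\<close>, to which the strong type
  inequality applies.\<close>

lemma hl_max_local:
  fixes g :: "'a::euclidean_space \<Rightarrow> ennreal"
  assumes [measurable]: "g \<in> borel_measurable borel" and p: "1 < p" and c: "0 < c" and R: "r \<le> R"
    and avg: "\<And>y t. R < t \<Longrightarrow>
      (\<integral>\<^sup>+ z\<in>ball y t. enn_powr (g z) p \<partial>lborel) \<le> ennreal (c powr p) * emeasure lborel (ball y t)"
  shows "(\<integral>\<^sup>+ y\<in>ball x r. enn_powr (hl_max g y) p \<partial>lborel)
    \<le> ennreal (strong_const p DIM('a)) * (\<integral>\<^sup>+ y\<in>ball x (2 * R). enn_powr (g y) p \<partial>lborel)
      + ennreal ((2 * c) powr p) * emeasure lborel (ball x r)"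
proof -
  have [measurable]: "ball x r \<in> sets borel" "ball x (2 * R) \<in> sets borel" by simp_all
  let ?h = "\<lambda>z. g z * indicator (ball x (2 * R)) z"
  \<comment> \<open>Bounding by a maximum rather than a sum lets the \<open>p\<close>-th powers be
    added without a further constant.\<close>
  have pw: "hl_max g y \<le> max (hl_max ?h y) (ennreal (2 * c))" if y: "y \<in> ball x r" for y
    unfolding hl_max_def[of g]
  proof (rule SUP_least)
    fix t :: real assume "t \<in> {0<..}"
    then have t: "0 < t" by simp
    show "(\<integral>\<^sup>+ z\<in>ball y t. g z \<partial>lborel) / emeasure lborel (ball y t) \<le> max (hl_max ?h y) (ennreal (2 * c))"
    proof (cases "t \<le> R")
      case True
      have "ball y t \<subseteq> ball x (2 * R)"
      proof
        fix z assume "z \<in> ball y t"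
        then show "z \<in> ball x (2 * R)"
          using y True R dist_triangle[of x z y] by simp
      qed
      then have "(\<integral>\<^sup>+ z\<in>ball y t. g z \<partial>lborel) = (\<integral>\<^sup>+ z\<in>ball y t. ?h z \<partial>lborel)"
        by (intro nn_integral_cong) (auto split: split_indicator)
      then have "(\<integral>\<^sup>+ z\<in>ball y t. g z \<partial>lborel) / emeasure lborel (ball y t) \<le> hl_max ?h y"
        using t by (auto simp: hl_max_def intro!: SUP_upper2[of t])
      then show ?thesis by (simp add: le_max_iff_disj)
    next
      case False
      then show ?thesis
        using hl_max_average_bound[OF assms(1) p c t avg, of y] by (simp add: le_max_iff_disj)
    qed
  qed
  have "(\<integral>\<^sup>+ y\<in>ball x r. enn_powr (hl_max g y) p \<partial>lborel)
    \<le> (\<integral>\<^sup>+ y. enn_powr (hl_max ?h y) p + ennreal ((2 * c) powr p) * indicator (ball x r) y \<partial>lborel)"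
  proof (rule nn_integral_mono)
    fix y
    show "enn_powr (hl_max g y) p * indicator (ball x r) y
      \<le> enn_powr (hl_max ?h y) p + ennreal ((2 * c) powr p) * indicator (ball x r) y"
    proof (cases "y \<in> ball x r")
      case True
      have "enn_powr (hl_max g y) p \<le> enn_powr (max (hl_max ?h y) (ennreal (2 * c))) p"
        using pw[OF True] p by (intro enn_powr_mono) auto
      also have "\<dots> \<le> enn_powr (hl_max ?h y) p + ennreal ((2 * c) powr p)"
        using enn_powr_max_le[of p "hl_max ?h y" "ennreal (2 * c)"] p c by simp
      finally show ?thesis using True by simp
    qed simp
  qed
  also have "\<dots> = (\<integral>\<^sup>+ y. enn_powr (hl_max ?h y) p \<partial>lborel) + ennreal ((2 * c) powr p) * emeasure lborel (ball x r)"
    by (subst nn_integral_add, measurable) (simp add: nn_integral_cmult_indicator)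
  also have "(\<integral>\<^sup>+ y. enn_powr (hl_max ?h y) p \<partial>lborel)
    \<le> ennreal (strong_const p DIM('a)) * (\<integral>\<^sup>+ y. enn_powr (?h y) p \<partial>lborel)"
    unfolding strong_const_def using p by (intro hl_max_strong_type) measurable
  also have "(\<integral>\<^sup>+ y. enn_powr (?h y) p \<partial>lborel) = (\<integral>\<^sup>+ y\<in>ball x (2 * R). enn_powr (g y) p \<partial>lborel)"
    by (intro nn_integral_cong) (auto split: split_indicator)
  finally show ?thesis by (simp add: add_right_mono)
qed

text \<open>\<open>A\<close> stands for the \<open>p\<close>-th power of the Morrey norm. Averages
  over radius \<open>t\<close> are at most a multiple of \<open>t powr (lam - DIM('a))\<close>,
  which does not increase with \<open>t\<close> since \<open>lam\<close> is at most the dimension,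
  so the value at \<open>R\<close> serves for all larger radii.\<close>

lemma hl_max_morrey_local:
  fixes g :: "'a::euclidean_space \<Rightarrow> ennreal" and lam :: real
  assumes [measurable]: "g \<in> borel_measurable borel" and p: "1 < p" and lam: "lam \<le> DIM('a)"
    and A: "0 < A" and r: "0 < r" and R: "r \<le> R"
    and morrey: "\<And>y t. 0 < t \<Longrightarrow> (\<integral>\<^sup>+ z\<in>ball y t. enn_powr (g z) p \<partial>lborel) \<le> ennreal (A * t powr lam)"
  shows "(\<integral>\<^sup>+ y\<in>ball x r. enn_powr (hl_max g y) p \<partial>lborel)
    \<le> ennreal (strong_const p DIM('a)) * (\<integral>\<^sup>+ y\<in>ball x (2 * R). enn_powr (g y) p \<partial>lborel)
      + ennreal (2 powr p * A * R powr (lam - DIM('a)) * r ^ DIM('a))"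
proof -
  define w where "w = unit_ball_vol DIM('a)"
  have w: "0 < w" by (simp add: w_def)
  \<comment> \<open>Makes \<open>c powr p * w\<close> equal to
    \<open>A * R powr (lam - DIM('a))\<close>, so the volume \<open>w\<close> of the unit ball
    cancels in the final bound.\<close>
  define c where "c = (A * R powr (lam - DIM('a)) / w) powr (1 / p)"
  have c: "0 < c" using w A r R by (simp add: c_def)
  have cp: "c powr p = A * R powr (lam - DIM('a)) / w"
    using w A r R p by (simp add: c_def powr_powr)
  have "(\<integral>\<^sup>+ z\<in>ball y t. enn_powr (g z) p \<partial>lborel) \<le> ennreal (c powr p) * emeasure lborel (ball y t)"
    if t: "R < t" for y t
  proof -
    have "0 < t" using t r R by simp
    have "t powr lam = t powr (lam - DIM('a)) * t ^ DIM('a)"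
      using \<open>0 < t\<close> by (simp add: powr_diff powr_realpow)
    also have "\<dots> \<le> R powr (lam - DIM('a)) * t ^ DIM('a)"
      using t r R lam by (intro mult_right_mono powr_mono2') auto
    finally have "A * t powr lam \<le> A * (R powr (lam - DIM('a)) * t ^ DIM('a))"
      using A by simp
    also have "\<dots> = c powr p * (w * t ^ DIM('a))"
      using w by (simp add: cp)
    finally have "ennreal (A * t powr lam) \<le> ennreal (c powr p) * emeasure lborel (ball y t)"
      using \<open>0 < t\<close> w by (simp add: emeasure_ball w_def[symmetric] ennreal_mult[symmetric])
    then show ?thesis using morrey[OF \<open>0 < t\<close>] by (rule order_trans[rotated])
  qed
  note hl_max_local[OF assms(1) p c R this, of x]
  moreover have "ennreal ((2 * c) powr p) * emeasure lborel (ball x r)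
    = ennreal (2 powr p * A * R powr (lam - DIM('a)) * r ^ DIM('a))"
    using A r c w by (simp add: emeasure_ball w_def[symmetric] ennreal_mult[symmetric] powr_mult cp)
  ultimately show ?thesis by simp
qed

text \<open>The local estimate with \<open>R = r\<close>: doubling the ball costs
  \<open>2 powr lam\<close>, and in the second term the powers of \<open>r\<close> combine to
  \<open>r powr lam\<close>.\<close>

lemma hl_max_morrey:
  fixes g :: "'a::euclidean_space \<Rightarrow> ennreal" and lam :: real
  assumes [measurable]: "g \<in> borel_measurable borel" and p: "1 < p" and lam: "lam \<le> DIM('a)"
    and A: "0 < A" and r: "0 < r"
    and morrey: "\<And>y t. 0 < t \<Longrightarrow> (\<integral>\<^sup>+ z\<in>ball y t. enn_powr (g z) p \<partial>lborel) \<le> ennreal (A * t powr lam)"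
  shows "(\<integral>\<^sup>+ y\<in>ball x r. enn_powr (hl_max g y) p \<partial>lborel)
    \<le> ennreal ((strong_const p DIM('a) * 2 powr lam + 2 powr p) * A * r powr lam)"
proof -
  have "(\<integral>\<^sup>+ y\<in>ball x r. enn_powr (hl_max g y) p \<partial>lborel)
    \<le> ennreal (strong_const p DIM('a)) * ennreal (A * (2 * r) powr lam)
      + ennreal (2 powr p * A * r powr (lam - DIM('a)) * r ^ DIM('a))"
    by (rule order_trans[OF hl_max_morrey_local[OF assms(1) p lam A r order_refl morrey]])
      (auto intro!: add_right_mono mult_left_mono morrey simp: r)
  also have "\<dots> = ennreal ((strong_const p DIM('a) * 2 powr lam + 2 powr p) * A * r powr lam)"
  proof -
    have "r powr (lam - DIM('a)) * r ^ DIM('a) = r powr lam"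
      using r by (simp add: powr_diff powr_realpow)
    then show ?thesis
      using r A strong_const_pos[OF p, of "DIM('a)"]
      by (simp add: ennreal_mult[symmetric] powr_mult mult.assoc distrib_right distrib_left algebra_simps flip: ennreal_plus)
  qed
  finally show ?thesis .
qed

text \<open>First fix \<open>R\<close> so large that the contribution of large radii is below
  \<open>e / 2\<close> for every \<open>x\<close>. Then cover \<open>ball x (2 * R)\<close> by
  translates of one finite family of unit balls and use the vanishing of \<open>g\<close> on each of
  them.\<close>

lemma hl_max_morrey_vanishing:
  fixes g :: "'a::euclidean_space \<Rightarrow> ennreal" and lam :: real
  assumes [measurable]: "g \<in> borel_measurable borel" and p: "1 < p" and lam: "lam < DIM('a)"
    and A: "0 < A" and e: "0 < e"
    and morrey: "\<And>y t. 0 < t \<Longrightarrow> (\<integral>\<^sup>+ z\<in>ball y t. enn_powr (g z) p \<partial>lborel) \<le> ennreal (A * t powr lam)"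
    and van: "\<And>e. 0 < e \<Longrightarrow> \<exists>N::nat. \<forall>x. (\<integral>\<^sup>+ z\<in>ball x 1 - ball 0 N. enn_powr (g z) p \<partial>lborel) \<le> ennreal e"
  shows "\<exists>N::nat. \<forall>x. (\<integral>\<^sup>+ z\<in>ball x 1 - ball 0 N. enn_powr (hl_max g z) p \<partial>lborel) \<le> ennreal e"
proof -
  let ?K = "strong_const p DIM('a)"
  have K: "0 < ?K" using p by (rule strong_const_pos)
  have "((\<lambda>R. 2 powr p * A * R powr (lam - DIM('a))) \<longlongrightarrow> 2 powr p * A * 0) at_top"
    using lam by (intro tendsto_mult tendsto_const tendsto_neg_powr filterlim_ident) auto
  then have "eventually (\<lambda>R. 2 powr p * A * R powr (lam - DIM('a)) < e / 2) at_top"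
    using e by (intro order_tendstoD) auto
  from eventually_happens[OF eventually_conj[OF this eventually_ge_at_top[of 1]]]
  obtain R where R: "2 powr p * A * R powr (lam - DIM('a)) < e / 2" "1 \<le> R"
    by auto
  \<comment> \<open>The cover is chosen once at the origin and translated by \<open>x\<close>, so
    its cardinality does not depend on \<open>x\<close>.\<close>
  obtain F where F: "finite F" "cball (0::'a) (2 * R) \<subseteq> (\<Union>z\<in>F. ball z 1)"
  proof (rule compactE_image[OF compact_cball, of UNIV "\<lambda>z. ball z 1" "0::'a" "2 * R"])
    show "cball 0 (2 * R) \<subseteq> (\<Union>z\<in>UNIV. ball z 1)"
      by (meson UN_I UNIV_I centre_in_ball subsetI zero_less_one)
  qed auto
  \<comment> \<open>Sized so that \<open>?K * card F * e'\<close> is at most \<open>e / 2\<close>;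
    the \<open>+ 1\<close> keeps the denominator positive without an argument that \<open>F\<close>
    is nonempty.\<close>
  define e' where "e' = e / (2 * ?K * (card F + 1))"
  have "0 < e'" using e K by (simp add: e'_def)
  then obtain N0 :: nat where N0: "\<And>x. (\<integral>\<^sup>+ z\<in>ball x 1 - ball 0 N0. enn_powr (g z) p \<partial>lborel) \<le> ennreal e'"
    using van by blast
  \<comment> \<open>If \<open>ball x 1\<close> contains a point of norm at least \<open>N\<close>,
    then every point of \<open>ball x (2 * R)\<close> has norm at least
    \<open>N - 1 - 2 * R\<close>, hence at least \<open>N0\<close>. Otherwise the domain of
    integration is empty.\<close>
  define N where "N = N0 + nat \<lceil>2 * R + 1\<rceil>"
  have "real N \<ge> N0 + (2 * R + 1)"
    unfolding N_def of_nat_add using real_nat_ceiling_ge[of "2 * R + 1"] by linarith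
  show ?thesis
  proof (intro exI[of _ N] allI)
    fix x
    show "(\<integral>\<^sup>+ z\<in>ball x 1 - ball 0 N. enn_powr (hl_max g z) p \<partial>lborel) \<le> ennreal e"
    proof (cases "ball x 1 \<subseteq> ball 0 N")
      case True
      then have empty: "ball x 1 - ball 0 N = {}" by blast
      show ?thesis unfolding empty by simp
    next
      case False
      then obtain y where "y \<in> ball x 1" "y \<notin> ball 0 N" by blast
      then have y: "dist x y < 1" "N \<le> norm y" by auto
      have sub: "ball x (2 * R) \<subseteq> (\<Union>z\<in>F. ball (x + z) 1 - ball 0 N0)"
      proof
        fix u assume u: "u \<in> ball x (2 * R)"
        then have "u - x \<in> cball 0 (2 * R)" by (simp add: dist_norm norm_minus_commute)
        then obtain z where z: "z \<in> F" "u - x \<in> ball z 1" using F by blast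
        have "u \<in> ball (x + z) 1" using z by (simp add: dist_norm algebra_simps)
        moreover have "N0 \<le> norm u"
          using u y \<open>real N \<ge> _\<close> dist_triangle[of y u x] norm_triangle_sub[of y u]
          by (simp add: dist_norm norm_minus_commute)
        ultimately show "u \<in> (\<Union>z\<in>F. ball (x + z) 1 - ball 0 N0)" using z by auto
      qed
      have "(\<integral>\<^sup>+ z\<in>ball x (2 * R). enn_powr (g z) p \<partial>lborel)
        \<le> (\<integral>\<^sup>+ u. (\<Sum>z\<in>F. enn_powr (g u) p * indicator (ball (x + z) 1 - ball 0 N0) u) \<partial>lborel)"
      proof (rule nn_integral_mono)
        fix u
        show "enn_powr (g u) p * indicator (ball x (2 * R)) u
          \<le> (\<Sum>z\<in>F. enn_powr (g u) p * indicator (ball (x + z) 1 - ball 0 N0) u)"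
        proof (cases "u \<in> ball x (2 * R)")
          case True
          then obtain z where z: "z \<in> F" "u \<in> ball (x + z) 1 - ball 0 N0" using sub by blast
          then have "enn_powr (g u) p * indicator (ball x (2 * R)) u
            = enn_powr (g u) p * indicator (ball (x + z) 1 - ball 0 N0) u"
            using True by simp
          also have "\<dots> \<le> (\<Sum>z\<in>F. enn_powr (g u) p * indicator (ball (x + z) 1 - ball 0 N0) u)"
            by (rule member_le_sum[OF z(1)]) (auto simp: F)
          finally show ?thesis .
        qed simp
      qed
      also have "\<dots> = (\<Sum>z\<in>F. \<integral>\<^sup>+ u\<in>ball (x + z) 1 - ball 0 N0. enn_powr (g u) p \<partial>lborel)"
        by (intro nn_integral_sum borel_measurable_times_ennreal borel_measurable_indicator
            borel_measurable_enn_powr) auto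
      also have "\<dots> \<le> (\<Sum>z\<in>F. ennreal e')"
        by (intro sum_mono N0)
      also have "\<dots> = ennreal (card F * e')"
        using \<open>0 < e'\<close> by (simp add: ennreal_mult ennreal_of_nat_eq_real_of_nat)
      finally have G: "(\<integral>\<^sup>+ z\<in>ball x (2 * R). enn_powr (g z) p \<partial>lborel) \<le> ennreal (card F * e')" .
      have "(\<integral>\<^sup>+ z\<in>ball x 1 - ball 0 N. enn_powr (hl_max g z) p \<partial>lborel)
        \<le> (\<integral>\<^sup>+ z\<in>ball x 1. enn_powr (hl_max g z) p \<partial>lborel)"
        by (intro nn_integral_mono) (auto split: split_indicator)
      also have "\<dots> \<le> ennreal ?K * ennreal (card F * e') + ennreal (2 powr p * A * R powr (lam - DIM('a)) * 1 ^ DIM('a))"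
        using lam R by (intro order_trans[OF hl_max_morrey_local[OF assms(1) p _ A _ _ morrey, of 1 R]])
          (auto intro!: add_right_mono mult_left_mono G)
      also have "\<dots> \<le> ennreal ?K * ennreal (card F * e') + ennreal (e / 2)"
        using R by (intro add_left_mono ennreal_leI) simp
      also have "\<dots> = ennreal (?K * (card F * e') + e / 2)"
        using K \<open>0 < e'\<close> e by (simp add: ennreal_mult)
      also have "\<dots> \<le> ennreal e"
      proof (rule ennreal_leI)
        have "?K * (card F * e') \<le> ?K * ((card F + 1) * e')"
          using K \<open>0 < e'\<close> by simp
        also have "\<dots> = e / 2" using K by (simp add: e'_def divide_simps)
        finally show "?K * (card F * e') + e / 2 \<le> e" by simp
      qed
      finally show ?thesis .
    qed
  qed
qed

subsection \<open>Morrey spaces in terms of nonnegative integrals\<close>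

lemma borel_measurable_norm_powr:
  fixes f :: "'a \<Rightarrow> 'k::real_normed_vector"
  assumes "f \<in> borel_measurable M"
  shows "(\<lambda>y. norm (f y) powr p) \<in> borel_measurable M"
proof -
  have [measurable]: "(\<lambda>y. norm (f y)) \<in> borel_measurable M"
    by (rule measurable_compose[OF assms borel_measurable_continuous_onI[OF continuous_on_norm_id]])
  show ?thesis by measurable
qed

text \<open>A change on a null set alters no average, so the equality holds at every point and not
  merely almost everywhere.\<close>

lemma maximal_function_eq_hl_max:
  fixes f :: "real ^ 'n \<Rightarrow> 'k::real_normed_field"
  assumes "AE y in lborel. ennreal (norm (f y)) = g y"
  shows "maximal_function f = hl_max g"
proof
  fix x
  have "(\<integral>\<^sup>+ y\<in>ball x t. ennreal (norm (f y)) \<partial>lborel) = (\<integral>\<^sup>+ y\<in>ball x t. g y \<partial>lborel)" for t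
    using assms by (intro nn_integral_cong_AE) auto
  then show "maximal_function f x = hl_max g x"
    by (simp add: maximal_function_def hl_max_def nn_integral_completion)
qed

text \<open>Here and below \<open>h\<close> is an extended-valued version of the \<open>p\<close>-th
  power of the norm. It will be \<open>enn_powr (g y) p\<close> for \<open>f\<close> itself and
  \<open>enn_powr (hl_max g y) p\<close> for its maximal function.\<close>

lemma set_nn_integral_norm_powr:
  fixes f :: "real ^ 'n \<Rightarrow> 'k::real_normed_field"
  assumes "AE y in lborel. ennreal (norm (f y) powr p) = h y"
  shows "(\<integral>\<^sup>+ y. ennreal (indicat_real S y *\<^sub>R (norm (f y) powr p)) \<partial>lebesgue) = (\<integral>\<^sup>+ y\<in>S. h y \<partial>lborel)"
  unfolding nn_integral_completion using assms
  by (intro nn_integral_cong_AE) (auto split: split_indicator)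

lemma set_lebesgue_integral_norm_powr:
  fixes f :: "real ^ 'n \<Rightarrow> 'k::real_normed_field"
  assumes f: "f \<in> borel_measurable lebesgue" and h: "AE y in lborel. ennreal (norm (f y) powr p) = h y"
    and [measurable]: "S \<in> sets lebesgue"
  shows "(LINT y:S|lebesgue. norm (f y) powr p) = enn2real (\<integral>\<^sup>+ y\<in>S. h y \<partial>lborel)"
proof -
  note [measurable] = borel_measurable_norm_powr[OF f, of p]
  show ?thesis
    unfolding set_lebesgue_integral_def set_nn_integral_norm_powr[OF h, symmetric]
    by (intro integral_eq_nn_integral) auto
qed

lemma set_integrable_norm_powr_iff:
  fixes f :: "real ^ 'n \<Rightarrow> 'k::real_normed_field"
  assumes f: "f \<in> borel_measurable lebesgue" and h: "AE y in lborel. ennreal (norm (f y) powr p) = h y"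
    and [measurable]: "S \<in> sets lebesgue"
  shows "set_integrable lebesgue S (\<lambda>y. norm (f y) powr p) \<longleftrightarrow> (\<integral>\<^sup>+ y\<in>S. h y \<partial>lborel) < \<infinity>"
proof -
  note [measurable] = borel_measurable_norm_powr[OF f, of p]
  have "set_integrable lebesgue S (\<lambda>y. norm (f y) powr p)
    \<longleftrightarrow> (\<integral>\<^sup>+ y. ennreal (norm (indicat_real S y *\<^sub>R (norm (f y) powr p))) \<partial>lebesgue) < \<infinity>"
    unfolding set_integrable_def integrable_iff_bounded by simp
  also have "\<dots> \<longleftrightarrow> (\<integral>\<^sup>+ y\<in>S. h y \<partial>lborel) < \<infinity>"
    using set_nn_integral_norm_powr[OF h, of S] by simp
  finally show ?thesis .
qed

lemma set_lebesgue_integral_outside_ball: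
  "(LINT y:ball x 1|lebesgue. norm (f y) powr p * indicator (- ball 0 (real N)) y)
    = (LINT y:ball x 1 - ball 0 (real N)|lebesgue. norm (f y) powr p)"
  unfolding set_lebesgue_integral_def
  by (intro Bochner_Integration.integral_cong) (auto split: split_indicator)

text \<open>Supplies the hypotheses of the estimates for \<open>hl_max\<close>. Since real integrals
  and real suprema take default values when infinite, finiteness and boundedness have to be
  established before they can be read as bounds.\<close>

lemma vanishing_morrey_spaceD:
  fixes f :: "real ^ 'n \<Rightarrow> 'k::real_normed_field"
  assumes mem: "f \<in> vanishing_morrey_space p lam" and p: "1 < p"
    and h: "AE y in lborel. ennreal (norm (f y) powr p) = h y"
  shows "0 \<le> morrey_norm p lam f"
    and "\<And>x r. 0 < r \<Longrightarrow> (\<integral>\<^sup>+ y\<in>ball x r. h y \<partial>lborel) \<le> ennreal (morrey_norm p lam f powr p * r powr lam)"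
    and "\<And>e. 0 < e \<Longrightarrow> \<exists>N::nat. \<forall>x. (\<integral>\<^sup>+ y\<in>ball x 1 - ball 0 N. h y \<partial>lborel) \<le> ennreal e"
proof -
  define D where "D = morrey_norm p lam f"
  have f: "f \<in> borel_measurable lebesgue"
    and int: "\<And>K. compact K \<Longrightarrow> set_integrable lebesgue K (\<lambda>y. norm (f y) powr p)"
    and bdd: "bdd_above ((\<lambda>(x, r). morrey_quotient p lam f x r) ` (UNIV \<times> {0<..}))"
    and lim: "(\<lambda>N::nat. SUP x. LINT y:ball x 1 - ball 0 (real N)|lebesgue. norm (f y) powr p) \<longlonglongrightarrow> 0"
    using mem by (auto simp: vanishing_morrey_space_def morrey_space_def locally_p_integrable_def
        set_lebesgue_integral_outside_ball)
  have q: "morrey_quotient p lam f x r \<le> D" if "0 < r" for x r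
    unfolding D_def morrey_norm_def
    using cSUP_upper[OF _ bdd, of "(x, r)"] that by simp
  have "0 \<le> morrey_quotient p lam f 0 1" by (simp add: morrey_quotient_def)
  also have "\<dots> \<le> D" by (rule q) simp
  finally show D: "0 \<le> morrey_norm p lam f" by (simp add: D_def)
  \<comment> \<open>Integrability on the compact closed ball excludes the case where
    \<open>enn2real\<close> would send an infinite integral to 0.\<close>
  have fin: "(\<integral>\<^sup>+ y\<in>ball x r. h y \<partial>lborel) < \<infinity>" for x r
  proof -
    have "set_integrable lebesgue (ball x r) (\<lambda>y. norm (f y) powr p)"
      by (rule set_integrable_subset[OF int[of "cball x r"]]) auto
    then show ?thesis using set_integrable_norm_powr_iff[OF f h, of "ball x r"] by simp
  qed
  have bound: "(\<integral>\<^sup>+ y\<in>ball x r. h y \<partial>lborel) \<le> ennreal (D powr p * r powr lam)" if r: "0 < r" for x r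
  proof -
    define I where "I = enn2real (\<integral>\<^sup>+ y\<in>ball x r. h y \<partial>lborel)"
    have "(1 / r powr lam * I) powr (1 / p) \<le> D"
      using q[OF r, of x] set_lebesgue_integral_norm_powr[OF f h, of "ball x r"]
      by (simp add: morrey_quotient_def I_def)
    then have "((1 / r powr lam * I) powr (1 / p)) powr p \<le> D powr p"
      using p by (intro powr_mono2) auto
    moreover have "0 \<le> I" by (simp add: I_def)
    ultimately have "I \<le> D powr p * r powr lam"
      using p r by (simp add: powr_powr field_simps)
    then have "ennreal I \<le> ennreal (D powr p * r powr lam)" by (rule ennreal_leI)
    moreover have "ennreal I = (\<integral>\<^sup>+ y\<in>ball x r. h y \<partial>lborel)"
      unfolding I_def using fin[of x r] by (intro ennreal_enn2real) simp
    ultimately show ?thesis by simp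
  qed
  then show "\<And>x r. 0 < r \<Longrightarrow> (\<integral>\<^sup>+ y\<in>ball x r. h y \<partial>lborel) \<le> ennreal (morrey_norm p lam f powr p * r powr lam)"
    by (simp add: D_def)
  \<comment> \<open>A bound uniform in \<open>x\<close>, so that the real supremum in the vanishing
    condition really dominates its terms.\<close>
  have le: "(\<integral>\<^sup>+ y\<in>ball x 1 - ball 0 (real N). h y \<partial>lborel) \<le> ennreal (D powr p)" for x and N :: nat
  proof -
    have "(\<integral>\<^sup>+ y\<in>ball x 1 - ball 0 (real N). h y \<partial>lborel) \<le> (\<integral>\<^sup>+ y\<in>ball x 1. h y \<partial>lborel)"
      by (intro nn_integral_mono) (auto split: split_indicator)
    then show ?thesis using bound[of 1 x] by simp
  qed
  show "\<exists>N::nat. \<forall>x. (\<integral>\<^sup>+ y\<in>ball x 1 - ball 0 N. h y \<partial>lborel) \<le> ennreal e" if e: "0 < e" for e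
  proof -
    obtain N :: nat where N: "(SUP x. LINT y:ball x 1 - ball 0 (real N)|lebesgue. norm (f y) powr p) < e"
      using order_tendstoD(2)[OF lim e] by (auto simp: eventually_sequentially)
    have "(\<integral>\<^sup>+ y\<in>ball x 1 - ball 0 (real N). h y \<partial>lborel) \<le> ennreal e" for x
    proof -
      have eq: "(LINT y:ball x 1 - ball 0 (real N)|lebesgue. norm (f y) powr p)
        = enn2real (\<integral>\<^sup>+ y\<in>ball x 1 - ball 0 (real N). h y \<partial>lborel)" for x
        by (rule set_lebesgue_integral_norm_powr[OF f h]) auto
      have "enn2real (\<integral>\<^sup>+ y\<in>ball x 1 - ball 0 (real N). h y \<partial>lborel) \<le> D powr p" for x
        by (rule enn2real_leI[OF _ le]) simp
      then have "bdd_above (range (\<lambda>x. LINT y:ball x 1 - ball 0 (real N)|lebesgue. norm (f y) powr p))"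
        unfolding eq by (rule bdd_aboveI2)
      then have "(LINT y:ball x 1 - ball 0 (real N)|lebesgue. norm (f y) powr p) < e"
        by (rule le_less_trans[OF cSUP_upper N, rotated]) simp
      then have "ennreal (enn2real (\<integral>\<^sup>+ y\<in>ball x 1 - ball 0 (real N). h y \<partial>lborel)) \<le> ennreal e"
        unfolding eq by (intro ennreal_leI) simp
      moreover have "(\<integral>\<^sup>+ y\<in>ball x 1 - ball 0 (real N). h y \<partial>lborel) < top"
        using le_less_trans[OF le[of x N] ennreal_less_top] .
      ultimately show ?thesis by (simp only: ennreal_enn2real)
    qed
    then show ?thesis by blast
  qed
qed

lemma morrey_quotient_le:
  fixes f :: "real ^ 'n \<Rightarrow> 'k::real_normed_field"
  assumes f: "f \<in> borel_measurable lebesgue" and p: "1 < p" and A: "0 \<le> A" and r: "0 < r"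
    and h: "AE y in lborel. ennreal (norm (f y) powr p) = h y"
    and morrey: "(\<integral>\<^sup>+ y\<in>ball x r. h y \<partial>lborel) \<le> ennreal (A * r powr lam)"
  shows "morrey_quotient p lam f x r \<le> A powr (1 / p)"
proof -
  have "(LINT y:ball x r|lebesgue. norm (f y) powr p) = enn2real (\<integral>\<^sup>+ y\<in>ball x r. h y \<partial>lborel)"
    by (rule set_lebesgue_integral_norm_powr[OF f h]) auto
  also have "\<dots> \<le> A * r powr lam"
    using morrey A r by (intro enn2real_leI) auto
  finally have "1 / r powr lam * (LINT y:ball x r|lebesgue. norm (f y) powr p) \<le> A"
    using r by (simp add: field_simps)
  then show ?thesis
    unfolding morrey_quotient_def using p
    by (intro powr_mono2) (auto intro!: mult_nonneg_nonneg simp: set_lebesgue_integral_def)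
qed

text \<open>The converse direction. A single \<open>N\<close> for each \<open>e\<close> is enough
  for the limit, because the integrals outside \<open>ball 0 N\<close> decrease as \<open>N\<close>
  grows.\<close>

lemma vanishing_morrey_spaceI:
  fixes f :: "real ^ 'n \<Rightarrow> 'k::real_normed_field"
  assumes f: "f \<in> borel_measurable lebesgue" and p: "1 < p" and A: "0 \<le> A"
    and h: "AE y in lborel. ennreal (norm (f y) powr p) = h y"
    and morrey: "\<And>x r. 0 < r \<Longrightarrow> (\<integral>\<^sup>+ y\<in>ball x r. h y \<partial>lborel) \<le> ennreal (A * r powr lam)"
    and van: "\<And>e. 0 < e \<Longrightarrow> \<exists>N::nat. \<forall>x. (\<integral>\<^sup>+ y\<in>ball x 1 - ball 0 N. h y \<partial>lborel) \<le> ennreal e"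
  shows "f \<in> vanishing_morrey_space p lam"
proof -
  have "set_integrable lebesgue K (\<lambda>y. norm (f y) powr p)" if K: "compact K" for K
  proof -
    obtain r where r: "0 < r" "K \<subseteq> ball 0 r"
      using bounded_subset_ballD[OF compact_imp_bounded[OF K], of 0] by auto
    have "(\<integral>\<^sup>+ y\<in>ball 0 r. h y \<partial>lborel) < \<infinity>"
      using le_less_trans[OF morrey[OF r(1)] ennreal_less_top] by simp
    then have "set_integrable lebesgue (ball 0 r) (\<lambda>y. norm (f y) powr p)"
      by (subst set_integrable_norm_powr_iff[OF f h]) auto
    from set_integrable_subset[OF this _ r(2)] show ?thesis
      using K by (simp add: fmeasurableD lmeasurable_compact)
  qed
  moreover have "bdd_above ((\<lambda>(x, r). morrey_quotient p lam f x r) ` (UNIV \<times> {0<..}))"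
    using morrey_quotient_le[OF f p A _ h morrey] by (intro bdd_aboveI[of _ "A powr (1 / p)"]) auto
  moreover have "(\<lambda>N::nat. SUP x. LINT y:ball x 1 - ball 0 (real N)|lebesgue. norm (f y) powr p) \<longlonglongrightarrow> 0"
  proof (rule LIMSEQ_I)
    fix e :: real assume "0 < e"
    \<comment> \<open>Half of \<open>e\<close>, since passing to the supremum preserves only the
      weak inequality.\<close>
    then obtain N where N: "\<And>x. (\<integral>\<^sup>+ y\<in>ball x 1 - ball 0 (real N). h y \<partial>lborel) \<le> ennreal (e / 2)"
      using van[of "e / 2"] by auto
    have "norm ((SUP x. LINT y:ball x 1 - ball 0 (real M)|lebesgue. norm (f y) powr p) - 0) < e" if "N \<le> M" for M
    proof -
      let ?L = "\<lambda>x. LINT y:ball x 1 - ball 0 (real M)|lebesgue. norm (f y) powr p"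
      have le: "?L x \<le> e / 2" for x
      proof -
        have eq: "?L x = enn2real (\<integral>\<^sup>+ y\<in>ball x 1 - ball 0 (real M). h y \<partial>lborel)"
          by (rule set_lebesgue_integral_norm_powr[OF f h]) auto
        have "(\<integral>\<^sup>+ y\<in>ball x 1 - ball 0 (real M). h y \<partial>lborel)
          \<le> (\<integral>\<^sup>+ y\<in>ball x 1 - ball 0 (real N). h y \<partial>lborel)"
          using \<open>N \<le> M\<close> by (intro nn_integral_mono) (auto split: split_indicator)
        from order_trans[OF this N[of x]]
        have "enn2real (\<integral>\<^sup>+ y\<in>ball x 1 - ball 0 (real M). h y \<partial>lborel) \<le> e / 2"
          using \<open>0 < e\<close> by (intro enn2real_leI) auto
        then show ?thesis by (simp add: eq)
      qed
      have "0 \<le> ?L 0" by (auto intro!: integral_nonneg simp: set_lebesgue_integral_def)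
      also have "\<dots> \<le> (SUP x. ?L x)"
        using le by (intro cSUP_upper bdd_aboveI2[of _ _ "e / 2"]) auto
      finally have "0 \<le> (SUP x. ?L x)" .
      moreover have "(SUP x. ?L x) \<le> e / 2" using le by (intro cSUP_least) auto
      ultimately show ?thesis using \<open>0 < e\<close> by simp
    qed
    then show "\<exists>N. \<forall>M\<ge>N. norm ((SUP x. LINT y:ball x 1 - ball 0 (real M)|lebesgue. norm (f y) powr p) - 0) < e"
      by blast
  qed
  ultimately show ?thesis using f
    by (simp add: vanishing_morrey_space_def morrey_space_def locally_p_integrable_def
        set_lebesgue_integral_outside_ball)
qed

section \<open>Boundedness of the maximal operator on the vanishing space\<close>

theorem theorem3p5:
  fixes p lam :: real
  assumes "1 < p" and "0 \<le> lam" and "lam < real CARD('n)"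
  shows "\<exists>C::real. \<forall>f \<in> (vanishing_morrey_space p lam :: (real ^ 'n \<Rightarrow> 'k::real_normed_field) set).
           (AE x in lebesgue. maximal_function f x < \<infinity>) \<and>
           maximal_operator f \<in> vanishing_morrey_space p lam \<and>
           morrey_norm p lam (maximal_operator f) \<le> C * morrey_norm p lam f"
proof -
  \<comment> \<open>The factor from \<open>hl_max_morrey\<close>; it bounds \<open>p\<close>-th
    powers, so the norm constant is \<open>K powr (1 / p)\<close>.\<close>
  define K where "K = strong_const p CARD('n) * 2 powr lam + 2 powr p"
  have K: "0 < K"
    using strong_const_pos[OF assms(1), of "CARD('n)"] unfolding K_def by (intro add_pos_pos mult_pos_pos) auto
  show ?thesis
  proof (intro exI[of _ "K powr (1 / p)"] ballI)
    fix f :: "real ^ 'n \<Rightarrow> 'k" assume mem: "f \<in> vanishing_morrey_space p lam"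
    then have f: "f \<in> borel_measurable lebesgue"
      by (simp add: vanishing_morrey_space_def morrey_space_def locally_p_integrable_def)
    have "(\<lambda>y. norm (f y)) \<in> borel_measurable lebesgue"
      by (rule measurable_compose[OF f borel_measurable_continuous_onI[OF continuous_on_norm_id]])
    then have "(\<lambda>y. ennreal (norm (f y))) \<in> borel_measurable lebesgue" by measurable
    \<comment> \<open>The passage from the Lebesgue measurable norm of \<open>f\<close> to a Borel
      function, as the estimates for \<open>hl_max\<close> require.\<close>
    from completion_ex_borel_measurable[OF this]
    obtain g where [measurable]: "g \<in> borel_measurable borel"
      and g: "AE y in lborel. ennreal (norm (f y)) = g y" by auto
    have gp: "AE y in lborel. ennreal (norm (f y) powr p) = enn_powr (g y) p"
      using g by eventually_elim (auto simp flip: enn_powr_ennreal)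
    note M = maximal_function_eq_hl_max[OF g]
    note D = vanishing_morrey_spaceD[OF mem assms(1) gp]
    define D where "D = morrey_norm p lam f"
    \<comment> \<open>The estimates need a positive Morrey bound while \<open>D\<close> may be 0, so
      any \<open>D'\<close> strictly above \<open>D\<close> is used and \<open>D'\<close> is lowered
      to \<open>D\<close> at the end.\<close>
    have morrey: "(\<integral>\<^sup>+ y\<in>ball x r. enn_powr (hl_max g y) p \<partial>lborel) \<le> ennreal (K * D' powr p * r powr lam)"
      if D': "D < D'" and r: "0 < r" for D' x r
    proof -
      have "(\<integral>\<^sup>+ z\<in>ball y t. enn_powr (g z) p \<partial>lborel) \<le> ennreal (D' powr p * t powr lam)" if "0 < t" for y t
        by (rule order_trans[OF D(2)[OF that]])
          (use D(1) D' assms(1) in \<open>auto simp: D_def intro!: ennreal_leI mult_right_mono powr_mono2\<close>)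
      moreover have "0 < D' powr p" using D(1) D' by (simp add: D_def)
      ultimately show ?thesis
        using hl_max_morrey[of g p lam "D' powr p" r x] assms r by (simp add: K_def)
    qed
    \<comment> \<open>Only convergence is claimed here, so the crude positive bound
      \<open>(D + 1) powr p\<close> is enough.\<close>
    have van: "\<exists>N::nat. \<forall>x. (\<integral>\<^sup>+ y\<in>ball x 1 - ball 0 N. enn_powr (hl_max g y) p \<partial>lborel) \<le> ennreal e"
      if "0 < e" for e
    proof (rule hl_max_morrey_vanishing[where A = "(D + 1) powr p" and lam = lam])
      show "(\<integral>\<^sup>+ z\<in>ball y t. enn_powr (g z) p \<partial>lborel) \<le> ennreal ((D + 1) powr p * t powr lam)" if "0 < t" for y t
        by (rule order_trans[OF D(2)[OF that]])
          (use D(1) assms(1) in \<open>auto simp: D_def intro!: ennreal_leI mult_right_mono powr_mono2\<close>)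
      show "0 < (D + 1) powr p" using D(1) by (simp add: D_def)
    qed (use assms D(3) \<open>0 < e\<close> in auto)
    \<comment> \<open>A finite integral of the power on a ball makes the maximal function finite
      almost everywhere there; countably many such balls exhaust the space.\<close>
    have "AE y in lborel. y \<in> ball 0 (real (Suc k)) \<longrightarrow> hl_max g y \<noteq> top" for k
    proof -
      have [measurable]: "ball (0 :: real ^ 'n) (real (Suc k)) \<in> sets borel" by simp
      have m: "(\<lambda>y. enn_powr (hl_max g y) p * indicator (ball 0 (real (Suc k))) y) \<in> borel_measurable lborel"
        by measurable
      have "(\<integral>\<^sup>+ y\<in>ball 0 (real (Suc k)). enn_powr (hl_max g y) p \<partial>lborel) < top"
        using le_less_trans[OF morrey[of "D + 1" "real (Suc k)"] ennreal_less_top] by simp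
      then have "AE y in lborel. enn_powr (hl_max g y) p * indicator (ball 0 (real (Suc k))) y \<noteq> \<infinity>"
        by (intro nn_integral_PInf_AE[OF m]) simp
      then show ?thesis by eventually_elim auto
    qed
    then have "AE y in lborel. \<forall>k. y \<in> ball 0 (real (Suc k)) \<longrightarrow> hl_max g y \<noteq> top"
      by (simp only: AE_all_countable) blast
    then have fin: "AE y in lborel. hl_max g y < \<infinity>"
    proof eventually_elim
      case (elim y)
      obtain k where "norm y < real (Suc k)"
        using reals_Archimedean2[of "norm y"] by (metis less_Suc_eq of_nat_less_iff order_less_trans)
      then show ?case using elim by (auto simp: less_top)
    qed
    \<comment> \<open>By \<open>fin\<close>, the value 0 that \<open>enn2real\<close> assigns to
      infinity matters only on a null set.\<close>
    have rep: "AE y in lborel. ennreal (norm (maximal_operator f y) powr p) = enn_powr (hl_max g y) p"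
      using fin by eventually_elim (auto simp: maximal_operator_def M enn_powr_def)
    have "(of_real :: real \<Rightarrow> 'k) \<in> borel_measurable borel"
      by (intro borel_measurable_continuous_onI continuous_intros)
    from measurable_compose[OF _ this]
    have "(\<lambda>x. of_real (enn2real (hl_max g x)) :: 'k) \<in> borel_measurable borel"
      by measurable
    then have meas: "maximal_operator f \<in> borel_measurable lebesgue"
      by (simp add: maximal_operator_def[abs_def] M measurable_completion)
    have "maximal_operator f \<in> vanishing_morrey_space p lam"
      using K by (intro vanishing_morrey_spaceI[OF meas assms(1) _ rep morrey[of "D + 1"] van]) auto
    moreover have "morrey_norm p lam (maximal_operator f) \<le> K powr (1 / p) * D"
    proof -
      have "morrey_norm p lam (maximal_operator f) \<le> K powr (1 / p) * D'" if "D < D'" for D'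
      proof -
        have "(K * D' powr p) powr (1 / p) = K powr (1 / p) * D'"
          using K D(1) that assms(1) by (simp add: powr_mult powr_powr D_def)
        then have "morrey_quotient p lam (maximal_operator f) x r \<le> K powr (1 / p) * D'" if "0 < r" for x r
          using morrey_quotient_le[OF meas assms(1) _ that rep morrey[OF \<open>D < D'\<close> that], of x] K by simp
        then show ?thesis unfolding morrey_norm_def by (intro cSUP_least) auto
      qed
      \<comment> \<open>Isolating \<open>D'\<close> puts the bound in the form in which density of
        the reals allows \<open>D'\<close> to be replaced by \<open>D\<close>.\<close>
      then have "morrey_norm p lam (maximal_operator f) / K powr (1 / p) \<le> D'" if "D < D'" for D'
        using that K by (simp add: field_simps)
      then have "morrey_norm p lam (maximal_operator f) / K powr (1 / p) \<le> D"
        by (rule dense_ge)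
      then show ?thesis using K by (simp add: field_simps)
    qed
    moreover have "AE x in lebesgue. maximal_function f x < \<infinity>"
      unfolding M using fin by (rule AE_completion)
    ultimately show "(AE x in lebesgue. maximal_function f x < \<infinity>) \<and>
           maximal_operator f \<in> vanishing_morrey_space p lam \<and>
           morrey_norm p lam (maximal_operator f) \<le> K powr (1 / p) * morrey_norm p lam f"
      by (simp add: D_def)
  qed
qed

end
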